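(* For every integer $n\ge 1$, $$g_n(x)=\frac1n\sum_{j=0}^{\lfloor (n-1)/2\rfloor}(-1)^j\,\frac{2^{\,n-2j-1}}{(n-2j-1)!}\,\bigl([u^{2j}](u\cot u)^n\bigr)\,x^{n-2j}.$$ Equivalently, for all integers $1\le r\le n$ with $r\equiv n\pmod 2$, $$[u^{n-r}](u\cot u)^n=(-1)^{(n-r)/2}\,\frac{n\,(r-1)!}{2^{r-1}}\,[x^r]g_n(x).$$
   Context: The Mittag--Leffler polynomials $g_n(x)$, $n\ge 0$, are defined by the formal power series identity in $t$ $$\sum_{n=0}^{\infty}g_n(x)t^n=\frac12\left(\frac{1+t}{1-t}\right)^x=\frac12\exp\bigl(2x\operatorname{artanh}t\bigr),$$ where $\operatorname{artanh}t=\sum_{k\ge0}t^{2k+1}/(2k+1)$. The notation $[z^k]F(z)$ denotes the coefficient of $z^k$ in the formal power series $F(z)$ at the origin. Here $u\cot u=u\cos u/\sin u$ is regarded as a formal power series in $u$ (with constant term $1$). *)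

theory Defs
  imports "HOL-Computational_Algebra.Computational_Algebra"
begin

definition fps_artanh :: "'a::field_char_0 fps" where
  "fps_artanh = Abs_fps (\<lambda>n. if odd n then 1 / of_nat n else 0)"

(*
  The indeterminate x is [:0, 1:], so the coefficients in t live in 'a poly. As fps_exp
  is only available over fields, exp (2 x t) is written out as the sum of (2 x)^k t^k / k!.
*)
definition mittag_leffler_gf :: "'a::field_char_0 poly fps" where
  "mittag_leffler_gf =
     fps_const [:1 / 2:] *
       (Abs_fps (\<lambda>k. smult (1 / fact k) ([:0, 2:] ^ k)) oo
        Abs_fps (\<lambda>n. [:fps_nth fps_artanh n:]))"

definition mittag_leffler :: "nat \<Rightarrow> 'a::field_char_0 poly" where
  "mittag_leffler n = fps_nth mittag_leffler_gf n"

(*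
  u cot u. Dividing a power series by one of positive subdegree cancels the common power
  of u; the two lemmas below show that the quotient is exact.
*)
definition fps_X_cot :: "'a::field_char_0 fps" where
  "fps_X_cot = fps_X * fps_cos 1 / fps_sin 1"


lemma fps_X_cot_mult_sin: "fps_X_cot * fps_sin 1 = fps_X * fps_cos 1"
proof -
  have s: "subdegree (fps_sin (1::'a)) = 1"
    by (rule subdegreeI) (auto simp: fps_sin_def)
  have "subdegree (fps_X * fps_cos (1::'a)) \<ge> 1"
    by (intro subdegree_geI) (auto simp: fps_cos_def fps_eq_iff intro!: exI[of _ 1])
  moreover have "fps_sin (1::'a) \<noteq> 0" using s by force
  ultimately have "fps_sin (1::'a) dvd fps_X * fps_cos 1"
    using s by (subst fps_dvd_iff) (auto simp: fps_cos_def fps_eq_iff intro!: exI[of _ 1])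
  thus ?thesis
    unfolding fps_X_cot_def by simp
qed

lemma fps_X_cot_nth_0: "fps_nth fps_X_cot 0 = 1"
proof -
  have "fps_nth (fps_X_cot * fps_sin 1 :: 'a fps) 1 = fps_nth (fps_X * fps_cos 1) 1"
    by (simp only: fps_X_cot_mult_sin)
  thus ?thesis
    by (simp add: fps_mult_nth_1 fps_sin_def fps_cos_def)
qed

lemma poly_mittag_leffler_exp:
  "Abs_fps (\<lambda>n. poly (mittag_leffler n) x) =
     fps_const (1 / 2) * (fps_exp (2 * x) oo fps_artanh)"
proof (rule fps_ext)
  fix n
  have pw: "fps_nth (Abs_fps (\<lambda>n. [:fps_nth f n:]) ^ k) m = [:fps_nth (f ^ k) m:]"
    for f :: "'a fps" and k m
  proof (induction k arbitrary: m)
    case (Suc k)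
    have sum: "(\<Sum>i\<in>A. [:h i:]) = [:\<Sum>i\<in>A. h i:]" for h :: "nat \<Rightarrow> 'a" and A
      by (induction A rule: infinite_finite_induct) auto
    show ?case by (simp add: fps_mult_nth Suc sum mult.commute)
  qed auto
  show "fps_nth (Abs_fps (\<lambda>n. poly (mittag_leffler n) x)) n =
        fps_nth (fps_const (1 / 2) * (fps_exp (2 * x) oo fps_artanh)) n"
    by (simp add: mittag_leffler_def mittag_leffler_gf_def fps_compose_nth pw poly_sum mult_ac)
qed

lemma poly_mittag_leffler_binomial:
  "Abs_fps (\<lambda>n. poly (mittag_leffler n) x) =
     fps_const (1 / 2) * (fps_binomial x oo ((1 + fps_X) / (1 - fps_X) - 1))"
proof -
  define u :: "'a fps" where "u = (1 + fps_X) / (1 - fps_X) - 1"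
  define w :: "'a fps" where "w = inverse (1 - fps_X)"
  have w: "(1 - fps_X) * w = 1"
    unfolding w_def by (rule inverse_mult_eq_1') simp
  have u_eq: "u = (1 + fps_X) * w - 1"
    unfolding u_def w_def by (subst fps_divide_unit) auto
  have u0: "fps_nth u 0 = 0" by (simp add: u_eq w_def)
  have "fps_deriv w = w\<^sup>2"
    by (simp add: w_def fps_inverse_deriv)
  hence du: "fps_deriv u = w + (1 + fps_X) * w\<^sup>2"
    by (simp add: u_eq)
  have bin: "fps_binomial x = fps_exp x oo fps_ln 1"
  proof -
    have "fps_deriv (fps_exp x oo fps_ln 1) = fps_const x * (fps_exp x oo fps_ln 1) / (1 + fps_X)"
      by (subst fps_compose_deriv)
         (simp_all add: fps_ln_deriv fps_compose_mult_distrib fps_divide_unit)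
    thus ?thesis by (subst eq_commute, subst fps_binomial_ODE_unique' [symmetric]) simp
  qed
  have inv: "inverse (1 + fps_X) oo u = inverse (1 + u)"
    using u0 by (subst fps_inverse_compose) (simp_all add: fps_compose_add_distrib)
  have iu: "inverse (1 + u) * (1 + u) = 1"
    by (rule inverse_mult_eq_1) (simp add: u0)
  have art: "(1 - fps_X\<^sup>2) * fps_deriv (fps_artanh :: 'a fps) = 1"
  proof (rule fps_ext)
    fix n
    have *: "fps_nth (fps_deriv (fps_artanh :: 'a fps)) m = (if even m then 1 else 0)" for m
      by (simp add: fps_artanh_def del: of_nat_Suc)
    show "fps_nth ((1 - fps_X\<^sup>2) * fps_deriv (fps_artanh :: 'a fps)) n = fps_nth 1 n"
      unfolding left_diff_distrib fps_sub_nth fps_X_power_mult_nth *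
      by (auto simp: * simp del: fps_deriv_nth)
  qed
  have "fps_ln 1 oo u = fps_const 2 * fps_artanh"
  proof -
    have d: "fps_deriv (fps_ln 1 oo u) = inverse (1 + u) * (w + (1 + fps_X) * w\<^sup>2)"
      using u0 by (simp add: fps_compose_deriv fps_ln_deriv inv du)
    have a: "1 + u = (1 + fps_X) * w" by (simp add: u_eq)
    have "(1 - fps_X\<^sup>2) * (w + (1 + fps_X) * w\<^sup>2) = 2 * (1 + u)"
    proof -
      have "(1 - fps_X\<^sup>2) * (w + (1 + fps_X) * w\<^sup>2) =
            (1 + fps_X) * ((1 - fps_X) * w) * (1 + (1 + fps_X) * w)"
        by (simp add: algebra_simps power2_eq_square)
      also have "\<dots> = (1 + fps_X) * (((1 - fps_X) * w) + (1 + fps_X) * w)" by (simp add: w)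
      also have "\<dots> = 2 * (1 + u)" unfolding a by (simp add: algebra_simps)
      finally show ?thesis .
    qed
    hence "(1 - fps_X\<^sup>2) * fps_deriv (fps_ln 1 oo u) = 2 * (inverse (1 + u) * (1 + u))"
      unfolding d by (metis mult.left_commute)
    also have "\<dots> = (1 - fps_X\<^sup>2) * fps_deriv (fps_const 2 * fps_artanh)"
      using art by (simp add: iu mult.left_commute numeral_fps_const)
    finally have "fps_deriv (fps_ln 1 oo u) = fps_deriv (fps_const 2 * fps_artanh)"
      using art by (metis mult_cancel_left mult_zero_left zero_neq_one)
    thus ?thesis
      by (subst (asm) fps_deriv_eq_iff) (simp add: fps_artanh_def)
  qed
  moreover have "fps_binomial x oo u = fps_exp x oo (fps_ln 1 oo u)"
    unfolding bin using u0 by (subst fps_compose_assoc) auto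
  moreover have "fps_exp x oo (fps_const 2 * fps_artanh) = fps_exp (2 * x) oo fps_artanh"
  proof -
    have "fps_exp (2 * x) oo fps_artanh = (fps_exp x oo (fps_const 2 * fps_X)) oo fps_artanh"
      by simp
    also have "\<dots> = fps_exp x oo ((fps_const 2 * fps_X) oo fps_artanh)"
      by (subst fps_compose_assoc) (auto simp: fps_artanh_def)
    also have "(fps_const 2 * fps_X) oo fps_artanh = fps_const (2::'a) * fps_artanh"
      by (subst fps_compose_mult_distrib) (auto simp: fps_artanh_def)
    finally show ?thesis ..
  qed
  ultimately show ?thesis
    unfolding poly_mittag_leffler_exp u_def by simp
qed

end

theory Submission
  imports Defs
begin

text \<open>
  The coefficient of $x^r$ in $g_n$ is $2^{r-1}/r!$ times that of $t^n$ in $(\mathrm{artanh}\, t)^r$.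
  Since arctan is the compositional inverse of tan, Lagrange inversion gives
  $n [t^n] (\arctan t)^r = r [u^{n-r}] (u \cot u)^n$. Over a field without a square root of $-1$,
  the passage between artanh and arctan is made by writing them as $t\, h(t^2)$ and $t\, h(-t^2)$
  for the same series $h$. Lagrange inversion itself comes from the invariance of residues of
  Laurent series under a substitution of order 1: up to a multiple of $1/t$, whose substitution is
  a logarithmic derivative, every Laurent series is a derivative.
\<close>

section \<open>Residues of Laurent series and Lagrange inversion\<close>

lemma fls_deriv_compose_fps:
  fixes F :: "'a::field_char_0 fls"
  assumes [simp]: "T \<noteq> 0" "fps_nth T 0 = 0"
  shows "fls_deriv (fls_compose_fps F T) =
           fls_compose_fps (fls_deriv F) T * fps_to_fls (fps_deriv T)"
proof -
  \<comment> \<open>Multiplying by \<open>fls_X ^ k\<close> clears the pole of \<open>F\<close>. The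
    chain rule for power series then applies to \<open>H\<close>, and the product rule carries it
    back to \<open>F\<close>.\<close>
  define k where "k = nat (- fls_subdegree F)"
  define H where "H = fls_regpart (F * fls_X ^ k)"
  define t t' where "t = fps_to_fls T" and "t' = fps_to_fls (fps_deriv T)"
  have t: "t \<noteq> 0" "fls_deriv t = t'"
    by (simp_all add: t_def t'_def fls_deriv_fps_to_fls)
  have H: "fps_to_fls H = F * fls_X ^ k"
  proof (cases "F = 0")
    case False
    hence "fls_subdegree (F * fls_X ^ k) \<ge> 0"
      by (simp add: fls_subdegree_mult_fls_X_power k_def)
    thus ?thesis
      unfolding H_def by simp
  qed (simp add: H_def)
  have "fls_deriv (fps_to_fls (H oo T)) = fls_compose_fps (fls_deriv (fps_to_fls H)) T * t'"
    by (simp add: fls_deriv_fps_to_fls fps_compose_deriv fls_times_fps_to_fls t'_def)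
  also have "fps_to_fls (H oo T) = fls_compose_fps F T * t ^ k"
    by (simp flip: fls_compose_fps_to_fls add: H fls_compose_fps_mult fls_compose_fps_power t_def)
  finally have "(fls_deriv (fls_compose_fps F T) - fls_compose_fps (fls_deriv F) T * t') * t ^ k = 0"
    by (simp add: H fls_compose_fps_mult fls_compose_fps_power fls_compose_fps_add
                  fls_deriv_power t algebra_simps flip: t_def)
  thus ?thesis
    using t by (simp add: t'_def)
qed

lemma fls_residue_compose_fps:
  fixes G :: "'a::field_char_0 fls"
  assumes "subdegree T = 1"
  shows "fls_residue (fls_compose_fps G T * fps_to_fls (fps_deriv T)) = fls_residue G"
proof -
  have [simp]: "T \<noteq> 0" "fps_nth T 0 = 0"
    using assms by (auto intro: nth_less_subdegree_zero)
  define c where "c = fls_residue G"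
  have "fls_residue (G - fls_const c * fls_X_inv) = 0"
    by (simp add: c_def)
  then obtain H where H: "fls_deriv H = G - fls_const c * fls_X_inv"
    using fls_residue_nonzero_ex_antiderivative by blast
  hence G: "G = fls_deriv H + fls_const c * inverse fls_X"
    by (simp add: fls_inverse_X)
  have "fls_compose_fps G T * fps_to_fls (fps_deriv T) =
        fls_deriv (fls_compose_fps H T) +
        fls_const c * (fls_deriv (fps_to_fls T) * inverse (fps_to_fls T))"
    unfolding G
    by (simp add: fls_compose_fps_add fls_compose_fps_mult fls_compose_fps_inverse
                  fls_deriv_compose_fps fls_deriv_fps_to_fls algebra_simps)
  \<comment> \<open>A derivative has residue 0, and the logarithmic derivative of \<open>T\<close>
    has residue \<open>subdegree T\<close>, which is 1.\<close>
  also have "fls_residue \<dots> = c"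
    unfolding fls_residue_add fls_residue_deriv fls_residue_fls_const_times
      fls_residue_deriv_times_inverse_eq_subdegree
    using assms by (simp add: fls_subdegree_fls_to_fps)
  finally show ?thesis by (simp add: c_def)
qed

text \<open>The left side is the residue of \<open>(F ^ r)' / X ^ n\<close>. Substituting
  \<open>T\<close> turns this into the residue of \<open>r * X ^ (r - 1) / T ^ n\<close>, and
  \<open>1 / T = Q / X\<close>.\<close>

lemma fps_lagrange_inversion:
  fixes F T Q :: "'a::field_char_0 fps"
  assumes T: "subdegree T = 1" and inv: "F oo T = fps_X" and Q: "Q * T = fps_X"
    and r: "1 \<le> r" "r \<le> n"
  shows "of_nat n * fps_nth (F ^ r) n = of_nat r * fps_nth (Q ^ n) (n - r)"
proof -
  have [simp]: "T \<noteq> 0" "fps_nth T 0 = 0"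
    using T by (auto intro: nth_less_subdegree_zero)
  define t q where "t = fps_to_fls T" and "q = fps_to_fls Q"
  have t: "t \<noteq> 0" by (simp add: t_def)
  have qt: "q * t = fls_X"
    by (simp add: q_def t_def Q flip: fls_times_fps_to_fls)
  hence "q \<noteq> 0" by auto
  with t have t_inv: "inverse t = q * inverse fls_X"
    by (simp add: field_simps flip: qt)
  have chain: "(fps_deriv (F ^ r) oo T) * fps_deriv T = of_nat r * fps_X ^ (r - 1)"
  proof -
    have "(fps_deriv (F ^ r) oo T) * fps_deriv T = fps_deriv (F ^ r oo T)"
      by (rule fps_compose_deriv [symmetric]) simp
    also have "F ^ r oo T = fps_X ^ r"
      by (simp add: inv flip: fps_compose_power)
    finally show ?thesis
      by (simp add: fps_deriv_power fps_of_nat)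
  qed
  \<comment> \<open>Dividing by \<open>X ^ n\<close> moves the coefficient at \<open>n - 1\<close>
    to exponent -1.\<close>
  have coeff: "fls_residue (fps_to_fls A * fls_X_inv ^ n) = fps_nth A (n - 1)" for A :: "'a fps"
    using r by (simp add: fls_X_inv_power_times_conv_shift nat_diff_distrib)
  have "of_nat n * fps_nth (F ^ r) n = fps_nth (fps_deriv (F ^ r)) (n - 1)"
    using r by (simp del: fps_deriv_power)
  also have "\<dots> = fls_residue (fps_to_fls (fps_deriv (F ^ r)) * inverse fls_X ^ n)"
    by (simp only: coeff fls_inverse_X)
  also have "\<dots> = fls_residue (fls_compose_fps (fps_to_fls (fps_deriv (F ^ r)) * inverse fls_X ^ n) T *
                     fps_to_fls (fps_deriv T))"
    by (rule fls_residue_compose_fps [OF T, symmetric])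
  also have "fls_compose_fps (fps_to_fls (fps_deriv (F ^ r)) * inverse fls_X ^ n) T *
                     fps_to_fls (fps_deriv T) =
             fps_to_fls ((fps_deriv (F ^ r) oo T) * fps_deriv T) * inverse t ^ n"
    by (simp add: fls_compose_fps_mult fls_compose_fps_power fls_compose_fps_inverse
                  fls_times_fps_to_fls t_def mult_ac del: fps_deriv_power)
  also have "\<dots> = fps_to_fls (of_nat r * fps_X ^ (r - 1) * Q ^ n) * fls_X_inv ^ n"
    unfolding chain t_inv
    by (simp add: q_def power_mult_distrib fls_times_fps_to_fls fps_to_fls_power fls_inverse_X mult_ac)
  \<comment> \<open>The factor \<open>fps_X ^ (r - 1)\<close> lowers the index from
    \<open>n - 1\<close> to \<open>n - r\<close>.\<close>
  also have "fls_residue \<dots> = of_nat r * fps_nth (Q ^ n) (n - r)"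
    using r unfolding coeff by (simp add: mult.assoc fps_X_power_mult_nth flip: fps_of_nat)
  finally show ?thesis .
qed

section \<open>Tangent and arctangent as power series\<close>

definition fps_artan :: "'a::field_char_0 fps" where
  "fps_artan = Abs_fps (\<lambda>n. if odd n then (-1) ^ (n div 2) / of_nat n else 0)"

lemma fps_cos_nonzero [simp]: "fps_cos c \<noteq> (0 :: 'a::field_char_0 fps)"
  by (metis fps_cos_nth_0 fps_zero_nth zero_neq_one)

lemma fps_tan_mult_cos: "fps_tan c * fps_cos c = (fps_sin c :: 'a::field_char_0 fps)"
proof -
  have "fps_cos c dvd (fps_sin c :: 'a fps)"
    by (simp add: fps_is_left_unit_iff_zeroth_is_left_unit unit_imp_dvd fps_is_unit_iff)
  thus ?thesis
    by (simp add: fps_tan_def)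
qed

text \<open>Differentiate \<open>tan * cos = sin\<close>, replace the sine by
  \<open>tan * cos\<close> and cancel the cosine.\<close>

lemma fps_tan_deriv_tan: "fps_deriv (fps_tan c) = fps_const c * (1 + (fps_tan c)\<^sup>2 :: 'a::field_char_0 fps)"
proof -
  have "fps_deriv (fps_tan c * fps_cos c :: 'a fps) = fps_const c * fps_cos c"
    by (simp add: fps_tan_mult_cos fps_sin_deriv)
  hence "fps_deriv (fps_tan c) * fps_cos c =
           fps_const c * fps_cos c + fps_const c * fps_tan c * (fps_sin c :: 'a fps)"
    by (simp add: fps_cos_deriv algebra_simps flip: fps_const_neg)
  also have "\<dots> = fps_const c * (1 + (fps_tan c)\<^sup>2) * fps_cos c"
    by (simp add: algebra_simps power2_eq_square flip: fps_tan_mult_cos)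
  finally show ?thesis by simp
qed

lemma subdegree_fps_tan: "c \<noteq> 0 \<Longrightarrow> subdegree (fps_tan c :: 'a::field_char_0 fps) = 1"
proof -
  assume c: "c \<noteq> 0"
  have 0: "fps_nth (fps_tan c) 0 = 0"
    using arg_cong [OF fps_tan_mult_cos [of c], of "\<lambda>f. fps_nth f 0"] by simp
  have "fps_nth (fps_deriv (fps_tan c)) 0 = c"
    by (simp add: fps_tan_deriv_tan 0 power2_eq_square del: fps_deriv_nth)
  with c 0 show ?thesis
    by (intro subdegreeI) auto
qed

text \<open>This makes \<open>fps_X_cot\<close> the series \<open>Q\<close> of Lagrange inversion
  for \<open>T = fps_tan 1\<close>.\<close>

lemma fps_X_cot_mult_tan: "fps_X_cot * fps_tan 1 = (fps_X :: 'a::field_char_0 fps)"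
proof -
  have "(fps_X_cot * fps_tan 1) * fps_cos 1 = (fps_X * fps_cos 1 :: 'a fps)"
    by (simp add: mult.assoc fps_tan_mult_cos fps_X_cot_mult_sin)
  thus ?thesis by simp
qed

lemma fps_artan_deriv: "(1 + fps_X\<^sup>2) * fps_deriv fps_artan = (1 :: 'a::field_char_0 fps)"
proof (rule fps_ext)
  fix n
  have d: "fps_nth (fps_deriv (fps_artan :: 'a fps)) m = (if even m then (-1) ^ (m div 2) else 0)" for m
    by (simp add: fps_artan_def del: of_nat_Suc)
  show "fps_nth ((1 + fps_X\<^sup>2) * fps_deriv fps_artan :: 'a fps) n = fps_nth 1 n"
  proof (cases "n < 2")
    \<comment> \<open>From index 2 on, the coefficients of the derivative at \<open>n\<close> and
      \<open>n - 2\<close> have opposite signs or both vanish.\<close>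
    case False
    then obtain m where "n = m + 2" by (metis add.commute le_add_diff_inverse not_less)
    thus ?thesis
      unfolding distrib_right fps_add_nth fps_X_power_mult_nth by (simp add: d del: fps_deriv_nth)
  qed (auto simp: distrib_right fps_X_power_mult_nth d less_2_cases_iff simp del: fps_deriv_nth)
qed

text \<open>Both sides have constant term 0 and derivative 1: the derivative
  \<open>1 + tan\<^sup>2\<close> of the tangent is \<open>1 + fps_X\<^sup>2\<close> with the tangent
  substituted.\<close>

lemma fps_artan_compose_tan: "fps_artan oo fps_tan 1 = (fps_X :: 'a::field_char_0 fps)"
proof -
  define T :: "'a fps" where "T = fps_tan 1"
  have T0: "fps_nth T 0 = 0"
    unfolding T_def by (rule nth_less_subdegree_zero) (simp add: subdegree_fps_tan)
  have "fps_deriv (fps_artan oo T) = ((1 + fps_X\<^sup>2) * fps_deriv fps_artan) oo T"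
    using T0 by (simp add: fps_compose_deriv fps_compose_mult_distrib fps_compose_add_distrib
                  fps_tan_deriv_tan T_def mult_ac flip: fps_compose_power)
  hence "fps_deriv (fps_artan oo T) = fps_deriv fps_X"
    by (simp add: fps_artan_deriv)
  thus ?thesis
    unfolding T_def by (subst (asm) fps_deriv_eq_iff) (simp add: fps_artan_def)
qed

section \<open>Comparison of the powers of arctan and artanh\<close>

lemma fps_artan_power_nth:
  "fps_nth (fps_artan ^ r :: 'a::field_char_0 fps) n = (-1) ^ ((n - r) div 2) * fps_nth (fps_artanh ^ r) n"
  and fps_artanh_power_nth_eq_0:
  "n < r \<or> r mod 2 \<noteq> n mod 2 \<Longrightarrow> fps_nth (fps_artanh ^ r :: 'a fps) n = 0"
proof -
  define h :: "'a fps" where "h = Abs_fps (\<lambda>n. 1 / of_nat (2 * n + 1))"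
  \<comment> \<open>The power equals \<open>X ^ r\<close> times a series in
    \<open>X\<^sup>2\<close>, so only exponents \<open>r + 2 * m\<close> occur. Replacing
    \<open>f\<close> by \<open>f(-X)\<close> multiplies the coefficient there by
    \<open>(-1) ^ m\<close>.\<close>
  have power: "fps_nth ((fps_X * (f oo fps_X\<^sup>2)) ^ r) n =
      (if r \<le> n \<and> even (n - r) then fps_nth (f ^ r) ((n - r) div 2) else 0)" for f :: "'a fps"
    by (simp add: power_mult_distrib fps_compose_power fps_X_power_mult_nth fps_nth_compose_X_power)
  have artanh: "fps_artanh = fps_X * (h oo fps_X\<^sup>2)"
    by (rule fps_ext) (auto simp: fps_artanh_def h_def fps_nth_compose_X_power elim!: oddE)
  have artan: "fps_artan = fps_X * ((h oo (fps_const (-1) * fps_X)) oo fps_X\<^sup>2)"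
    by (rule fps_ext)
       (auto simp: fps_artan_def h_def fps_nth_compose_X_power simp del: fps_const_neg elim!: oddE)
  show "fps_nth (fps_artan ^ r :: 'a fps) n = (-1) ^ ((n - r) div 2) * fps_nth (fps_artanh ^ r) n"
  proof (cases "r \<le> n \<and> even (n - r)")
    case True
    show ?thesis
      unfolding artan artanh power if_P [OF True]
      by (simp add: fps_compose_power del: fps_const_neg)
  next
    \<comment> \<open>Here \<open>(n - r) div 2\<close> may be truncated or rounded, but both
      coefficients are 0.\<close>
    case False
    show ?thesis
      unfolding artan artanh power if_not_P [OF False] by simp
  qed
  show "fps_nth (fps_artanh ^ r :: 'a fps) n = 0" if "n < r \<or> r mod 2 \<noteq> n mod 2"
  proof -
    from that have "\<not> (r \<le> n \<and> even (n - r))"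
      by (auto simp: mod2_eq_if split: if_splits)
    thus ?thesis unfolding artanh power by (rule if_not_P)
  qed
qed

section \<open>Coefficients of the Mittag-Leffler polynomials\<close>

lemma coeff_mittag_leffler:
  "coeff (mittag_leffler n :: 'a::field_char_0 poly) r =
     2 ^ r / (2 * fact r) * fps_nth (fps_artanh ^ r) n"
proof -
  \<comment> \<open>Embedding scalars as constant polynomials is a ring homomorphism, hence
    compatible with powers of series.\<close>
  have const_power: "fps_nth (Abs_fps (\<lambda>n. [:fps_nth f n:]) ^ k) m = [:fps_nth (f ^ k) m:]"
    for f :: "'a fps" and k m
  proof (induction k arbitrary: m)
    case (Suc k)
    have "(\<Sum>i\<in>A. [:h i:]) = [:\<Sum>i\<in>A. h i:]" for h :: "nat \<Rightarrow> 'a" and A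
      by (induction A rule: infinite_finite_induct) auto
    thus ?case by (simp add: fps_mult_nth Suc mult.commute)
  qed auto
  have X_power: "[:0, 2:] ^ k = monom (2 ^ k :: 'a) k" for k
  proof -
    have "[:0, 2:] = monom (2 :: 'a) 1" by (simp add: monom_Suc monom_0)
    thus ?thesis by (simp add: monom_power)
  qed
  \<comment> \<open>The \<open>k\<close>-th term of the composition is a monomial of degree
    \<open>k\<close> in x, so only \<open>k = r\<close> contributes. The sum stops at
    \<open>k = n\<close>; for \<open>r > n\<close> the right side is 0 as well.\<close>
  show ?thesis
    by (auto simp: fps_artanh_power_nth_eq_0 mittag_leffler_def mittag_leffler_gf_def fps_compose_nth const_power X_power
          coeff_sum smult_monom if_distrib cong: if_cong)
qed

lemma fps_X_cot_power_nth:
  fixes n r :: nat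
  assumes r: "1 \<le> r" "r \<le> n"
  shows "fps_nth (fps_X_cot ^ n :: 'a::field_char_0 fps) (n - r) =
              (-1) ^ ((n - r) div 2) * (of_nat n * fact (r - 1) / 2 ^ (r - 1)) *
              coeff (mittag_leffler n) r"
proof -
  have "of_nat n * fps_nth (fps_artan ^ r :: 'a fps) n =
          of_nat r * fps_nth (fps_X_cot ^ n) (n - r)"
    using r by (intro fps_lagrange_inversion [OF subdegree_fps_tan fps_artan_compose_tan
                                               fps_X_cot_mult_tan]) auto
  \<comment> \<open>Splitting off one factor cancels the \<open>r\<close> of Lagrange inversion and
    the 1/2 of the generating function.\<close>
  moreover have "fact r = of_nat r * (fact (r - 1) :: 'a)" "2 ^ r = 2 * (2 ^ (r - 1) :: 'a)"
    using r by (simp_all add: fact_reduce power_eq_if)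
  ultimately show ?thesis
    using r by (simp add: coeff_mittag_leffler fps_artan_power_nth field_simps)
qed

lemma smult_sum_right: "smult c (\<Sum>i\<in>A. f i) = (\<Sum>i\<in>A. smult c (f i))"
  by (induction A rule: infinite_finite_induct) (simp_all add: smult_add_right)

theorem theorem3p4:
  shows "(\<forall>n\<ge>1. (mittag_leffler n :: 'a::field_char_0 poly) =
            smult (1 / of_nat n)
              (\<Sum>j=0..(n - 1) div 2.
                 monom ((-1) ^ j * (2 ^ (n - 2 * j - 1) / fact (n - 2 * j - 1)) *
                        fps_nth (fps_X_cot ^ n) (2 * j))
                       (n - 2 * j))) \<and>
         (\<forall>n r. 1 \<le> r \<and> r \<le> n \<and> r mod 2 = n mod 2 \<longrightarrow>
            fps_nth (fps_X_cot ^ n :: 'a fps) (n - r) =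
              (-1) ^ ((n - r) div 2) * (of_nat n * fact (r - 1) / 2 ^ (r - 1)) *
              coeff (mittag_leffler n) r)"
proof (intro conjI allI impI)
  fix n :: nat assume n: "n \<ge> 1"
  define g where "g = (mittag_leffler n :: 'a poly)"
  have "smult (1 / of_nat n)
              (\<Sum>j=0..(n - 1) div 2.
                 monom ((-1) ^ j * (2 ^ (n - 2 * j - 1) / fact (n - 2 * j - 1)) *
                        fps_nth (fps_X_cot ^ n) (2 * j))
                       (n - 2 * j)) = (\<Sum>j=0..(n - 1) div 2. monom (coeff g (n - 2 * j)) (n - 2 * j))"
    unfolding smult_sum_right
  proof (intro sum.cong refl)
    fix j assume "j \<in> {0..(n - 1) div 2}"
    hence j: "2 * j < n" using n by auto
    \<comment> \<open>Take \<open>r = n - 2 * j\<close>, which is at least 1. The two signs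
      \<open>(-1) ^ j\<close> then multiply to 1.\<close>
    have "fps_nth (fps_X_cot ^ n :: 'a fps) (2 * j) = (-1) ^ j *
        (of_nat n * fact (n - 2 * j - 1) / 2 ^ (n - 2 * j - 1)) * coeff g (n - 2 * j)"
      using fps_X_cot_power_nth [of "n - 2 * j" n, where 'a = 'a] j by (simp add: g_def)
    thus "smult (1 / of_nat n) (monom ((-1) ^ j * (2 ^ (n - 2 * j - 1) / fact (n - 2 * j - 1)) *
                        fps_nth (fps_X_cot ^ n) (2 * j)) (n - 2 * j)) =
          monom (coeff g (n - 2 * j)) (n - 2 * j)"
      using n by (simp add: smult_monom field_simps flip: power_mult_distrib)
  qed
  \<comment> \<open>It remains to see that the monomials of \<open>g\<close> have only exponents
    between 1 and \<open>n\<close> of the parity of \<open>n\<close>.\<close>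
  also have "\<dots> = g"
  proof (rule poly_eqI)
    fix r
    have "coeff (\<Sum>j=0..(n - 1) div 2. monom (coeff g (n - 2 * j)) (n - 2 * j)) r =
          (\<Sum>j\<in>{0..(n - 1) div 2}. if n - 2 * j = r then coeff g r else 0)"
      by (auto simp: coeff_sum intro!: sum.cong)
    also have "\<dots> = coeff g r"
    proof (cases "1 \<le> r \<and> r \<le> n \<and> r mod 2 = n mod 2")
      case True
      define m where "m = (n - r) div 2"
      have "even (n - r)"
        using True by (simp add: mod2_eq_if split: if_splits)
      with True have m: "n = r + 2 * m"
        by (simp add: m_def)
      have r: "1 \<le> r" using True by simp
      \<comment> \<open>Since \<open>r\<close> is positive, truncated subtraction cannot produce a
        spurious solution \<open>j\<close>.\<close>
      have "n - 2 * j = r \<longleftrightarrow> j = m" for j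
        using r m by linarith
      moreover have "m \<in> {0..(n - 1) div 2}"
        using r m by auto
      ultimately show ?thesis by (simp only: sum.delta finite_atLeastAtMost if_True)
    next
      case False
      have "coeff g r = 0"
      \<comment> \<open>For even \<open>n\<close>, exponent 0 has the right parity but is not
        reached by the sum; its coefficient in \<open>g\<close> vanishes because
        \<open>fps_artanh ^ 0 = 1\<close> and \<open>n\<close> is positive.\<close>
      proof (cases "r = 0")
        case True
        thus ?thesis using n by (simp add: g_def coeff_mittag_leffler)
      next
        case r: False
        have "n < r \<or> r mod 2 \<noteq> n mod 2"
          using False r by auto
        thus ?thesis by (simp add: g_def coeff_mittag_leffler fps_artanh_power_nth_eq_0)
      qed
      thus ?thesis by (auto intro!: sum.neutral)
    qed
    finally show "coeff (\<Sum>j=0..(n - 1) div 2. monom (coeff g (n - 2 * j)) (n - 2 * j)) r = coeff g r" .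
  qed
  finally show "(mittag_leffler n :: 'a poly) =
            smult (1 / of_nat n)
              (\<Sum>j=0..(n - 1) div 2.
                 monom ((-1) ^ j * (2 ^ (n - 2 * j - 1) / fact (n - 2 * j - 1)) *
                        fps_nth (fps_X_cot ^ n) (2 * j))
                       (n - 2 * j))"
    by (simp add: g_def)
qed (blast intro: fps_X_cot_power_nth)

end
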